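(* Let $R$ be an associative ring with $1$ and let $\sigma$ be a left exact preradical on $R\text{-Mod}$. If each simple left $R$-module $S$ with $\sigma(S)=S$ is parainjective, then $R$ is a left $\sigma$-max ring.
   Context: $R\text{-Mod}$ is the category of left $R$-modules. A preradical $\sigma$ on $R\text{-Mod}$ assigns to each module $M$ a submodule $\sigma(M)\le M$ such that $f(\sigma(M))\subseteq\sigma(N)$ for every morphism $f:M\to N$. It is left exact if $\sigma(A)=A\cap\sigma(B)$ whenever $A\le B$. A module $S$ is parainjective if for every module $N$ such that there is a monomorphism $S\to N$ there is an epimorphism $N\to S$. A nonzero module $M$ is $\sigma$-coatomic if every quotient $L$ of $M$ with $\sigma(L)\neq0$ has a simple quotient $S$ with $\sigma(S)=S$. $R$ is a left $\sigma$-max ring if every nonzero left $R$-module is $\sigma$-coatomic. *)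

theory Defs
  imports "HOL-Algebra.Module"
begin

text \<open>
  The locale \<^locale>\<open>module\<close> of the library requires a commutative ring of scalars. The locale
  below has the same axioms over an arbitrary associative ring with one. The fields
  \<^const>\<open>mult\<close> and \<^const>\<open>one\<close> of a module record carry no meaning.
\<close>

locale left_module = R?: ring R + M?: abelian_group M
  for R :: "('r, 'x) ring_scheme" (structure) and M :: "('r, 'm, 'y) module_scheme" (structure) +
  assumes smult_closed:
      "\<lbrakk>a \<in> carrier R; x \<in> carrier M\<rbrakk> \<Longrightarrow> a \<odot>\<^bsub>M\<^esub> x \<in> carrier M"
    and smult_l_distr:
      "\<lbrakk>a \<in> carrier R; b \<in> carrier R; x \<in> carrier M\<rbrakk> \<Longrightarrow>
        (a \<oplus> b) \<odot>\<^bsub>M\<^esub> x = a \<odot>\<^bsub>M\<^esub> x \<oplus>\<^bsub>M\<^esub> b \<odot>\<^bsub>M\<^esub> x"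
    and smult_r_distr:
      "\<lbrakk>a \<in> carrier R; x \<in> carrier M; y \<in> carrier M\<rbrakk> \<Longrightarrow>
        a \<odot>\<^bsub>M\<^esub> (x \<oplus>\<^bsub>M\<^esub> y) = a \<odot>\<^bsub>M\<^esub> x \<oplus>\<^bsub>M\<^esub> a \<odot>\<^bsub>M\<^esub> y"
    and smult_assoc:
      "\<lbrakk>a \<in> carrier R; b \<in> carrier R; x \<in> carrier M\<rbrakk> \<Longrightarrow>
        (a \<otimes> b) \<odot>\<^bsub>M\<^esub> x = a \<odot>\<^bsub>M\<^esub> (b \<odot>\<^bsub>M\<^esub> x)"
    and smult_one:
      "x \<in> carrier M \<Longrightarrow> \<one> \<odot>\<^bsub>M\<^esub> x = x"

lemma left_module_cring_iff: "cring R \<Longrightarrow> left_module R M \<longleftrightarrow> module R M"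
  by (auto simp: left_module_def left_module_axioms_def module_def module_axioms_def cring_def)

definition lmod_hom ::
    "('r, 'x) ring_scheme \<Rightarrow> ('r, 'm) module \<Rightarrow> ('r, 'm) module \<Rightarrow> ('m \<Rightarrow> 'm) set" where
  "lmod_hom R M N = {f. f \<in> carrier M \<rightarrow> carrier N \<and>
     (\<forall>x\<in>carrier M. \<forall>y\<in>carrier M. f (x \<oplus>\<^bsub>M\<^esub> y) = f x \<oplus>\<^bsub>N\<^esub> f y) \<and>
     (\<forall>a\<in>carrier R. \<forall>x\<in>carrier M. f (a \<odot>\<^bsub>M\<^esub> x) = a \<odot>\<^bsub>N\<^esub> f x)}"

definition lmod_mono ::
    "('r, 'x) ring_scheme \<Rightarrow> ('r, 'm) module \<Rightarrow> ('r, 'm) module \<Rightarrow> ('m \<Rightarrow> 'm) set" where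
  "lmod_mono R M N = {f \<in> lmod_hom R M N. inj_on f (carrier M)}"

definition lmod_epi ::
    "('r, 'x) ring_scheme \<Rightarrow> ('r, 'm) module \<Rightarrow> ('r, 'm) module \<Rightarrow> ('m \<Rightarrow> 'm) set" where
  "lmod_epi R M N = {f \<in> lmod_hom R M N. f ` carrier M = carrier N}"

definition nonzero_lmod :: "('r, 'm) module \<Rightarrow> bool" where
  "nonzero_lmod M \<longleftrightarrow> carrier M \<noteq> {\<zero>\<^bsub>M\<^esub>}"

definition simple_lmod :: "('r, 'x) ring_scheme \<Rightarrow> ('r, 'm) module \<Rightarrow> bool" where
  "simple_lmod R M \<longleftrightarrow> left_module R M \<and> nonzero_lmod M \<and>
     (\<forall>H. submodule H R M \<longrightarrow> H = {\<zero>\<^bsub>M\<^esub>} \<or> H = carrier M)"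

text \<open>
  Throughout, \<open>R\<close>-Mod is represented by the left \<open>R\<close>-modules whose carrier is a set of elements
  of the type \<^typ>\<open>'m\<close>, which is a type variable and so stands for an arbitrary universe.
  This collection contains, up to isomorphism, all submodules and all quotients of its members: a
  quotient is realised on a set of coset representatives. Accordingly a quotient of \<open>M\<close> is a
  module onto which \<open>M\<close> maps epimorphically, which avoids the change of carrier type that
  a module of cosets would cause.
\<close>

definition lmod_quotient ::
    "('r, 'x) ring_scheme \<Rightarrow> ('r, 'm) module \<Rightarrow> ('r, 'm) module \<Rightarrow> bool" where
  "lmod_quotient R M L \<longleftrightarrow> left_module R L \<and> (\<exists>f. f \<in> lmod_epi R M L)"

definition preradical ::
    "('r, 'x) ring_scheme \<Rightarrow> (('r, 'm) module \<Rightarrow> 'm set) \<Rightarrow> bool" where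
  "preradical R \<sigma> \<longleftrightarrow>
     (\<forall>M. left_module R M \<longrightarrow> submodule (\<sigma> M) R M) \<and>
     (\<forall>M N f. left_module R M \<longrightarrow> left_module R N \<longrightarrow> f \<in> lmod_hom R M N \<longrightarrow>
        f ` \<sigma> M \<subseteq> \<sigma> N)"

definition left_exact_preradical ::
    "('r, 'x) ring_scheme \<Rightarrow> (('r, 'm) module \<Rightarrow> 'm set) \<Rightarrow> bool" where
  "left_exact_preradical R \<sigma> \<longleftrightarrow> preradical R \<sigma> \<and>
     (\<forall>B A. left_module R B \<longrightarrow> submodule A R B \<longrightarrow>
        \<sigma> (B\<lparr>carrier := A\<rparr>) = A \<inter> \<sigma> B)"

definition parainjective :: "('r, 'x) ring_scheme \<Rightarrow> ('r, 'm) module \<Rightarrow> bool" where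
  "parainjective R S \<longleftrightarrow> left_module R S \<and>
     (\<forall>N. left_module R N \<longrightarrow> (\<exists>f. f \<in> lmod_mono R S N) \<longrightarrow> (\<exists>g. g \<in> lmod_epi R N S))"

definition coatomic ::
    "('r, 'x) ring_scheme \<Rightarrow> (('r, 'm) module \<Rightarrow> 'm set) \<Rightarrow> ('r, 'm) module \<Rightarrow> bool" where
  "coatomic R \<sigma> M \<longleftrightarrow> left_module R M \<and> nonzero_lmod M \<and>
     (\<forall>L. lmod_quotient R M L \<longrightarrow> \<sigma> L \<noteq> {\<zero>\<^bsub>L\<^esub>} \<longrightarrow>
        (\<exists>S. lmod_quotient R L S \<and> simple_lmod R S \<and> \<sigma> S = carrier S))"

definition left_max_ring ::
    "('r, 'x) ring_scheme \<Rightarrow> (('r, 'm) module \<Rightarrow> 'm set) \<Rightarrow> bool" where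
  "left_max_ring R \<sigma> \<longleftrightarrow> ring R \<and>
     (\<forall>M. left_module R M \<longrightarrow> nonzero_lmod M \<longrightarrow> coatomic R \<sigma> M)"

end

theory Submission
  imports Defs
begin

text \<open>
  Let \<open>x\<close> be a nonzero element of \<open>\<sigma> L\<close> and let \<open>K\<close> be maximal among the submodules of \<open>L\<close> that avoid
  \<open>x\<close>. Every nonzero submodule of \<open>L/K\<close> contains the image of \<open>x\<close>, so that image generates a simple
  submodule \<open>S\<close>, and \<open>\<sigma> S = S\<close> by left exactness. Since \<open>S\<close> embeds in \<open>L/K\<close>, parainjectivity gives
  an epimorphism from \<open>L/K\<close> onto \<open>S\<close>, which makes \<open>S\<close> a quotient of \<open>L\<close>.
\<close>

section \<open>Elementary calculus of left modules and their submodules\<close>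

context left_module
begin

lemma smult_zero_left: "x \<in> carrier M \<Longrightarrow> \<zero> \<odot>\<^bsub>M\<^esub> x = \<zero>\<^bsub>M\<^esub>"
  by (metis M.add.r_cancel_one' R.l_zero R.zero_closed smult_closed smult_l_distr)

lemma smult_zero_right:
  assumes "a \<in> carrier R"
  shows "a \<odot>\<^bsub>M\<^esub> \<zero>\<^bsub>M\<^esub> = \<zero>\<^bsub>M\<^esub>"
  by (metis M.add.r_cancel_one' M.l_zero M.zero_closed assms smult_closed smult_r_distr)

lemma smult_minus_one:
  assumes "x \<in> carrier M"
  shows "(\<ominus> \<one>) \<odot>\<^bsub>M\<^esub> x = \<ominus>\<^bsub>M\<^esub> x"
proof -
  have "(\<ominus> \<one>) \<odot>\<^bsub>M\<^esub> x \<oplus>\<^bsub>M\<^esub> x = \<zero>\<^bsub>M\<^esub>"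
    using assms smult_l_distr[of "\<ominus> \<one>" \<one> x]
    by (simp add: smult_one smult_zero_left R.l_neg)
  with assms show ?thesis
    by (metis M.minus_equality R.a_inv_closed R.one_closed smult_closed)
qed

text \<open>Additive inverses come from the scalar action: negation is multiplication by
  \<open>\<ominus> \<one>\<close>, so closure under scalars covers it.\<close>

lemma submoduleI':
  assumes "H \<subseteq> carrier M" "\<zero>\<^bsub>M\<^esub> \<in> H"
    and "\<And>x y. x \<in> H \<Longrightarrow> y \<in> H \<Longrightarrow> x \<oplus>\<^bsub>M\<^esub> y \<in> H"
    and smult: "\<And>a x. a \<in> carrier R \<Longrightarrow> x \<in> H \<Longrightarrow> a \<odot>\<^bsub>M\<^esub> x \<in> H"
  shows "submodule H R M"
proof (intro submodule.intro submodule_axioms.intro)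
  have "\<ominus>\<^bsub>M\<^esub> x \<in> H" if "x \<in> H" for x
    using smult[of "\<ominus> \<one>" x] smult_minus_one[of x] that assms(1) by auto
  then show "subgroup H (add_monoid M)"
    using assms(1-3) by (auto simp: subgroup_def a_inv_def)
qed (use smult in auto)

lemma submoduleD:
  assumes "submodule H R M"
  shows "H \<subseteq> carrier M" "\<zero>\<^bsub>M\<^esub> \<in> H"
    and "\<And>x y. x \<in> H \<Longrightarrow> y \<in> H \<Longrightarrow> x \<oplus>\<^bsub>M\<^esub> y \<in> H"
    and "\<And>x. x \<in> H \<Longrightarrow> \<ominus>\<^bsub>M\<^esub> x \<in> H"
    and "\<And>a x. a \<in> carrier R \<Longrightarrow> x \<in> H \<Longrightarrow> a \<odot>\<^bsub>M\<^esub> x \<in> H"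
  using assms by (auto simp: submodule_def submodule_axioms_def subgroup_def a_inv_def)

lemma left_module_submodule:
  assumes "submodule H R M"
  shows "left_module R (M\<lparr>carrier := H\<rparr>)"
proof -
  note H = submoduleD[OF assms]
  have in_M: "x \<in> carrier M" if "x \<in> H" for x using H(1) that by auto
  have "abelian_group (M\<lparr>carrier := H\<rparr>)"
  proof (rule abelian_groupI)
    show "\<exists>y\<in>carrier (M\<lparr>carrier := H\<rparr>). y \<oplus>\<^bsub>M\<lparr>carrier := H\<rparr>\<^esub> x = \<zero>\<^bsub>M\<lparr>carrier := H\<rparr>\<^esub>"
      if "x \<in> carrier (M\<lparr>carrier := H\<rparr>)" for x
      using that H(4) in_M by (auto intro!: bexI[of _ "\<ominus>\<^bsub>M\<^esub> x"] M.l_neg)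
  qed (use H in_M in \<open>auto simp: M.a_assoc intro: M.a_comm\<close>)
  then show ?thesis
    using H in_M smult_l_distr smult_r_distr smult_assoc smult_one
    by (auto intro!: left_module.intro left_module_axioms.intro R.ring_axioms)
qed

text \<open>Distributivity and associativity, read from right to left, bring sums and multiples of
  scalar multiples of \<open>x\<close> back to the form \<open>a x\<close>. Such a cyclic submodule
  later serves as the simple module.\<close>

lemma submodule_cyclic:
  assumes x: "x \<in> carrier M"
  shows "submodule ((\<lambda>a. a \<odot>\<^bsub>M\<^esub> x) ` carrier R) R M"
proof (rule submoduleI')
  show "\<zero>\<^bsub>M\<^esub> \<in> (\<lambda>a. a \<odot>\<^bsub>M\<^esub> x) ` carrier R"
    using smult_zero_left[OF x] by (metis R.zero_closed imageI)
next
  fix y z assume "y \<in> (\<lambda>a. a \<odot>\<^bsub>M\<^esub> x) ` carrier R" "z \<in> (\<lambda>a. a \<odot>\<^bsub>M\<^esub> x) ` carrier R"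
  then show "y \<oplus>\<^bsub>M\<^esub> z \<in> (\<lambda>a. a \<odot>\<^bsub>M\<^esub> x) ` carrier R"
    using smult_l_distr[OF _ _ x, symmetric] by auto
next
  fix a y assume "a \<in> carrier R" "y \<in> (\<lambda>a. a \<odot>\<^bsub>M\<^esub> x) ` carrier R"
  then show "a \<odot>\<^bsub>M\<^esub> y \<in> (\<lambda>a. a \<odot>\<^bsub>M\<^esub> x) ` carrier R"
    using smult_assoc[OF _ _ x, symmetric] by auto
qed (use x smult_closed in auto)

text \<open>Zorn's lemma applies because the union of a chain of submodules avoiding
  \<open>x\<close> is a submodule that still avoids \<open>x\<close>.\<close>

lemma ex_maximal_submodule_avoiding:
  assumes x: "x \<in> carrier M" "x \<noteq> \<zero>\<^bsub>M\<^esub>"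
  obtains K where "submodule K R M" "x \<notin> K"
    "\<And>H. submodule H R M \<Longrightarrow> K \<subseteq> H \<Longrightarrow> x \<notin> H \<Longrightarrow> H = K"
proof -
  let ?A = "{H. submodule H R M \<and> x \<notin> H}"
  have "\<exists>K\<in>?A. \<forall>H\<in>?A. K \<subseteq> H \<longrightarrow> H = K"
  proof (rule subset_Zorn_nonempty)
    \<comment> \<open>The zero submodule avoids \<open>x\<close> exactly because \<open>x\<close> is
      nonzero.\<close>
    have "submodule {\<zero>\<^bsub>M\<^esub>} R M"
      by (rule submoduleI') (auto simp: smult_zero_right)
    with x(2) show "?A \<noteq> {}" by auto
  next
    fix C assume "C \<noteq> {}" and C: "subset.chain ?A C"
    then obtain H0 where H0: "H0 \<in> C" by auto
    from C have sub: "submodule H R M" "x \<notin> H" if "H \<in> C" for H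
      using that by (auto simp: subset.chain_def)
    have "submodule (\<Union>C) R M"
    proof (rule submoduleI')
      fix y z assume "y \<in> \<Union>C" "z \<in> \<Union>C"
      then obtain H1 H2 where H: "H1 \<in> C" "y \<in> H1" "H2 \<in> C" "z \<in> H2" by auto
      with C have "H1 \<subseteq> H2 \<or> H2 \<subseteq> H1" by (auto simp: subset.chain_def)
      \<comment> \<open>The larger of the two comparable members contains both elements.\<close>
      with H obtain H where "H \<in> C" "y \<in> H" "z \<in> H" by auto
      with submoduleD(3)[OF sub(1)] show "y \<oplus>\<^bsub>M\<^esub> z \<in> \<Union>C" by blast
    next
      fix a y assume a: "a \<in> carrier R" and "y \<in> \<Union>C"
      then obtain H where "H \<in> C" "y \<in> H" by auto
      with a submoduleD(5)[OF sub(1)] show "a \<odot>\<^bsub>M\<^esub> y \<in> \<Union>C" by auto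
    qed (use submoduleD(1)[OF sub(1)] submoduleD(2)[OF sub(1)[OF H0]] H0 in auto)
    with sub(2) show "\<Union>C \<in> ?A" by auto
  qed
  with that show ?thesis by auto
qed

end

section \<open>Quotient modules\<close>

text \<open>The quotient is carried by a choice of coset representatives.\<close>

lemma ex_quotient_module:
  fixes M :: "('r, 'm) module"
  assumes "left_module R M" and K: "submodule K R M"
  obtains Q :: "('r, 'm) module" and q where "left_module R Q" "q \<in> lmod_epi R M Q"
    "\<And>x. x \<in> carrier M \<Longrightarrow> q x = \<zero>\<^bsub>Q\<^esub> \<longleftrightarrow> x \<in> K"
proof -
  interpret M: left_module R M by fact
  note KD = M.submoduleD[OF K]
  have minus_zero: "\<ominus>\<^bsub>M\<^esub> \<zero>\<^bsub>M\<^esub> = \<zero>\<^bsub>M\<^esub>"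
    by (rule M.M.minus_equality) auto
  \<comment> \<open>\<open>q x\<close> is the chosen representative of the coset of
    \<open>x\<close>; the choice is possible since \<open>x\<close> lies in its own coset.\<close>
  define q where "q x = (SOME y. y \<in> carrier M \<and> x \<ominus>\<^bsub>M\<^esub> y \<in> K)" for x
  have q: "q x \<in> carrier M" "x \<ominus>\<^bsub>M\<^esub> q x \<in> K" if "x \<in> carrier M" for x
  proof -
    have "x \<in> carrier M \<and> x \<ominus>\<^bsub>M\<^esub> x \<in> K"
      using that KD(2) by (simp add: M.M.minus_eq M.M.r_neg)
    from someI[of "\<lambda>y. y \<in> carrier M \<and> x \<ominus>\<^bsub>M\<^esub> y \<in> K", OF this]
    show "q x \<in> carrier M" "x \<ominus>\<^bsub>M\<^esub> q x \<in> K" by (auto simp: q_def)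
  qed
  have diff_add: "a \<ominus>\<^bsub>M\<^esub> c = (a \<ominus>\<^bsub>M\<^esub> b) \<oplus>\<^bsub>M\<^esub> (b \<ominus>\<^bsub>M\<^esub> c)"
    if "a \<in> carrier M" "b \<in> carrier M" "c \<in> carrier M" for a b c
    using that by (simp add: M.M.minus_eq M.M.a_assoc M.M.r_neg1)
  have diff_swap: "b \<ominus>\<^bsub>M\<^esub> a = \<ominus>\<^bsub>M\<^esub> (a \<ominus>\<^bsub>M\<^esub> b)"
    if "a \<in> carrier M" "b \<in> carrier M" for a b
    using that by (simp add: M.M.minus_eq M.M.minus_add M.M.a_comm)
  have q_eqI: "q x = q y" if "x \<in> carrier M" "y \<in> carrier M" "x \<ominus>\<^bsub>M\<^esub> y \<in> K" for x y
  proof -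
    \<comment> \<open>Congruent elements satisfy equivalent selection predicates, so
      \<open>SOME\<close> returns the same representative for both.\<close>
    have "x \<ominus>\<^bsub>M\<^esub> w \<in> K \<longleftrightarrow> y \<ominus>\<^bsub>M\<^esub> w \<in> K" if "w \<in> carrier M" for w
      using diff_add[of x y w] diff_add[of y x w] diff_swap[of x y] KD(3,4) that
        \<open>x \<in> carrier M\<close> \<open>y \<in> carrier M\<close> \<open>x \<ominus>\<^bsub>M\<^esub> y \<in> K\<close> by metis
    then show ?thesis unfolding q_def by metis
  qed
  have q_diff: "q x \<ominus>\<^bsub>M\<^esub> x \<in> K" if "x \<in> carrier M" for x
    using q[OF that] diff_swap[of x "q x"] KD(4) that by metis
  have q_add: "q (q x \<oplus>\<^bsub>M\<^esub> q y) = q (x \<oplus>\<^bsub>M\<^esub> y)"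
    if "x \<in> carrier M" "y \<in> carrier M" for x y
  proof (rule q_eqI)
    have "(q x \<oplus>\<^bsub>M\<^esub> q y) \<ominus>\<^bsub>M\<^esub> (x \<oplus>\<^bsub>M\<^esub> y) = (q x \<ominus>\<^bsub>M\<^esub> x) \<oplus>\<^bsub>M\<^esub> (q y \<ominus>\<^bsub>M\<^esub> y)"
      using that q(1) by (simp add: M.M.minus_eq M.M.minus_add M.M.a_ac)
    then show "(q x \<oplus>\<^bsub>M\<^esub> q y) \<ominus>\<^bsub>M\<^esub> (x \<oplus>\<^bsub>M\<^esub> y) \<in> K"
      using that by (simp add: KD(3) q_diff)
  qed (use that q(1) in auto)
  have q_smult: "q (a \<odot>\<^bsub>M\<^esub> q x) = q (a \<odot>\<^bsub>M\<^esub> x)"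
    if "a \<in> carrier R" "x \<in> carrier M" for a x
  proof (rule q_eqI)
    \<comment> \<open>Distributivity over a difference is obtained by adding \<open>a x\<close> back
      and then cancelling it.\<close>
    have "a \<odot>\<^bsub>M\<^esub> (q x \<ominus>\<^bsub>M\<^esub> x) \<oplus>\<^bsub>M\<^esub> a \<odot>\<^bsub>M\<^esub> x = a \<odot>\<^bsub>M\<^esub> q x"
      using that q(1)
      by (simp add: M.smult_r_distr[symmetric] M.M.minus_eq M.M.a_assoc M.M.l_neg)
    then have "a \<odot>\<^bsub>M\<^esub> q x \<ominus>\<^bsub>M\<^esub> a \<odot>\<^bsub>M\<^esub> x = a \<odot>\<^bsub>M\<^esub> (q x \<ominus>\<^bsub>M\<^esub> x)"
      using that q(1) M.smult_closed
      by (metis M.M.a_assoc M.M.a_inv_closed M.M.minus_closed M.M.minus_eq M.M.r_neg M.M.r_zero)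
    then show "a \<odot>\<^bsub>M\<^esub> q x \<ominus>\<^bsub>M\<^esub> a \<odot>\<^bsub>M\<^esub> x \<in> K"
      using that by (simp add: KD(5) q_diff)
  qed (use that q(1) M.smult_closed in auto)
  \<comment> \<open>Each operation is that of \<open>M\<close> followed by a return to the
    representative. The carrier is a subset of that of \<open>M\<close>, so \<open>Q\<close> has the
    same type as \<open>M\<close>.\<close>
  define Q where "Q = M\<lparr>carrier := q ` carrier M, zero := q \<zero>\<^bsub>M\<^esub>,
    add := (\<lambda>u v. q (u \<oplus>\<^bsub>M\<^esub> v)), smult := (\<lambda>a u. q (a \<odot>\<^bsub>M\<^esub> u))\<rparr>"
  have Q_carrier: "carrier Q = q ` carrier M" and Q_zero: "\<zero>\<^bsub>Q\<^esub> = q \<zero>\<^bsub>M\<^esub>"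
    by (simp_all add: Q_def)
  have Q_add: "q x \<oplus>\<^bsub>Q\<^esub> q y = q (x \<oplus>\<^bsub>M\<^esub> y)" if "x \<in> carrier M" "y \<in> carrier M" for x y
    using that by (simp add: Q_def q_add)
  have Q_smult: "a \<odot>\<^bsub>Q\<^esub> q x = q (a \<odot>\<^bsub>M\<^esub> x)" if "a \<in> carrier R" "x \<in> carrier M" for a x
    using that by (simp add: Q_def q_smult)
  note Q_simps = Q_carrier Q_zero Q_add Q_smult M.smult_closed
  have "abelian_group Q"
  proof (rule abelian_groupI)
    fix u assume "u \<in> carrier Q"
    then obtain x where x: "x \<in> carrier M" "u = q x" by (auto simp: Q_carrier)
    then show "\<exists>v\<in>carrier Q. v \<oplus>\<^bsub>Q\<^esub> u = \<zero>\<^bsub>Q\<^esub>"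
      by (intro bexI[of _ "q (\<ominus>\<^bsub>M\<^esub> x)"]) (auto simp: Q_simps M.M.l_neg)
  next
    fix u v assume "u \<in> carrier Q" "v \<in> carrier Q"
    then show "u \<oplus>\<^bsub>Q\<^esub> v = v \<oplus>\<^bsub>Q\<^esub> u"
      by (auto simp: Q_simps M.M.a_comm)
  qed (auto simp: Q_simps M.M.a_assoc)
  then have "left_module R Q"
    by (intro left_module.intro left_module_axioms.intro M.R.ring_axioms)
      (auto simp: Q_simps M.smult_l_distr M.smult_r_distr M.smult_assoc M.smult_one)
  moreover have "q \<in> lmod_epi R M Q"
    by (auto simp: lmod_epi_def lmod_hom_def Q_simps)
  moreover have "q x = \<zero>\<^bsub>Q\<^esub> \<longleftrightarrow> x \<in> K" if x: "x \<in> carrier M" for x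
  proof
    assume "q x = \<zero>\<^bsub>Q\<^esub>"
    \<comment> \<open>The zero of \<open>Q\<close> is the representative of the coset
      \<open>K\<close>, which may differ from the zero of \<open>M\<close> but does lie in
      \<open>K\<close>.\<close>
    then have "q x \<in> K"
      using q_diff[of "\<zero>\<^bsub>M\<^esub>"] q(1)[OF x] by (simp add: Q_zero M.M.minus_eq minus_zero)
    then have "(x \<ominus>\<^bsub>M\<^esub> q x) \<oplus>\<^bsub>M\<^esub> q x \<in> K"
      using q(2)[OF x] by (rule KD(3)[rotated])
    then show "x \<in> K"
      using x q(1)[OF x] by (simp add: M.M.minus_eq M.M.a_assoc M.M.l_neg)
  next
    assume "x \<in> K"
    then show "q x = \<zero>\<^bsub>Q\<^esub>"
      using x by (auto simp: Q_zero M.M.minus_eq minus_zero intro!: q_eqI)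
  qed
  ultimately show ?thesis using that by blast
qed

section \<open>Preimages, nested submodules and composites\<close>

lemma submodule_vimage:
  assumes "left_module R M" "left_module R N" "f \<in> lmod_hom R M N" and H: "submodule H R N"
  shows "submodule {x \<in> carrier M. f x \<in> H} R M"
proof -
  interpret M: left_module R M by fact
  interpret N: left_module R N by fact
  note f = assms(3)[unfolded lmod_hom_def]
  have "f \<zero>\<^bsub>M\<^esub> = \<zero>\<^bsub>N\<^esub>"
  proof -
    \<comment> \<open>Preservation of zero is not part of \<open>lmod_hom\<close>; it follows from
      linearity at the zero scalar.\<close>
    have "f (\<zero>\<^bsub>R\<^esub> \<odot>\<^bsub>M\<^esub> \<zero>\<^bsub>M\<^esub>) = \<zero>\<^bsub>R\<^esub> \<odot>\<^bsub>N\<^esub> f \<zero>\<^bsub>M\<^esub>" and "f \<zero>\<^bsub>M\<^esub> \<in> carrier N"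
      using f by auto
    then show ?thesis by (simp add: M.smult_zero_right N.smult_zero_left)
  qed
  then show ?thesis
    using f N.submoduleD[OF H] M.smult_closed by (intro M.submoduleI') auto
qed

text \<open>Shrinking the carrier leaves zero, addition and scalar action unchanged, so the closure
  conditions are the same in both modules.\<close>

lemma submodule_of_submodule:
  assumes "left_module R M" "submodule A R M" "submodule H R (M\<lparr>carrier := A\<rparr>)"
  shows "submodule H R M" "H \<subseteq> A"
proof -
  interpret M: left_module R M by fact
  interpret A: left_module R "M\<lparr>carrier := A\<rparr>"
    using assms(2) by (rule M.left_module_submodule)
  note H = A.submoduleD[OF assms(3)]
  from H(1) show "H \<subseteq> A" by simp
  then show "submodule H R M"
    using H M.submoduleD(1)[OF assms(2)] by (intro M.submoduleI') auto
qed

lemma lmod_epi_comp: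
  assumes "f \<in> lmod_epi R M N" "g \<in> lmod_epi R N P"
  shows "g \<circ> f \<in> lmod_epi R M P"
proof -
  have "(g \<circ> f) ` carrier M = carrier P"
    using assms by (simp only: lmod_epi_def mem_Collect_eq image_comp[symmetric])
  moreover have "g \<circ> f \<in> lmod_hom R M P"
    using assms by (auto simp: lmod_epi_def lmod_hom_def Pi_iff)
  ultimately show ?thesis by (simp add: lmod_epi_def)
qed

section \<open>Simple quotients from parainjectivity\<close>

lemma ex_simple_quotient:
  fixes R :: "('r, 'x) ring_scheme" and L :: "('r, 'm) module"
  assumes \<sigma>: "left_exact_preradical R \<sigma>"
    and para: "\<And>S :: ('r, 'm) module. simple_lmod R S \<Longrightarrow> \<sigma> S = carrier S \<Longrightarrow> parainjective R S"
    and L: "left_module R L" "\<sigma> L \<noteq> {\<zero>\<^bsub>L\<^esub>}"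
  shows "\<exists>S. lmod_quotient R L S \<and> simple_lmod R S \<and> \<sigma> S = carrier S"
proof -
  interpret L: left_module R L by fact
  have sub\<sigma>: "submodule (\<sigma> N) R N" if "left_module R N" for N :: "('r, 'm) module"
    using \<sigma> that by (auto simp: left_exact_preradical_def preradical_def)
  note \<sigma>L = L.submoduleD[OF sub\<sigma>[OF L(1)]]
  from \<sigma>L(2) L(2) obtain x where x: "x \<in> \<sigma> L" "x \<noteq> \<zero>\<^bsub>L\<^esub>" by auto
  with \<sigma>L(1) have xL: "x \<in> carrier L" by auto
  obtain K where K: "submodule K R L" "x \<notin> K"
    and K_max: "\<And>H. submodule H R L \<Longrightarrow> K \<subseteq> H \<Longrightarrow> x \<notin> H \<Longrightarrow> H = K"
    using L.ex_maximal_submodule_avoiding[OF xL x(2)] by metis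
  obtain Q :: "('r, 'm) module" and q where Q: "left_module R Q" and q: "q \<in> lmod_epi R L Q"
    and ker: "\<And>y. y \<in> carrier L \<Longrightarrow> q y = \<zero>\<^bsub>Q\<^esub> \<longleftrightarrow> y \<in> K"
    using ex_quotient_module[OF L(1) K(1)] by metis
  interpret Q: left_module R Q by fact
  have q_hom: "q \<in> lmod_hom R L Q" and q_surj: "q ` carrier L = carrier Q"
    using q by (auto simp: lmod_epi_def)
  define z where "z = q x"
  have zQ: "z \<in> carrier Q" using xL q_surj by (auto simp: z_def)
  \<comment> \<open>If \<open>H\<close> avoids \<open>z\<close>, its preimage under \<open>q\<close>
    avoids \<open>x\<close> and contains \<open>K\<close>, hence equals \<open>K\<close> by
    maximality; then \<open>H\<close> is the image of \<open>K\<close>, which is zero.\<close>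
  have z_in: "z \<in> H" if H: "submodule H R Q" "H \<noteq> {\<zero>\<^bsub>Q\<^esub>}" for H
  proof (rule ccontr)
    assume "z \<notin> H"
    let ?P = "{y \<in> carrier L. q y \<in> H}"
    have "K \<subseteq> ?P"
    proof
      fix y assume y: "y \<in> K"
      then have "y \<in> carrier L" using L.submoduleD(1)[OF K(1)] by auto
      with y show "y \<in> ?P" using ker[of y] Q.submoduleD(2)[OF H(1)] by simp
    qed
    with \<open>z \<notin> H\<close> have "?P = K"
      by (intro K_max submodule_vimage[OF L(1) Q q_hom H(1)]) (auto simp: z_def)
    have "H \<subseteq> {\<zero>\<^bsub>Q\<^esub>}"
    proof
      fix u assume u: "u \<in> H"
      then obtain y where y: "y \<in> carrier L" "u = q y"
        using Q.submoduleD(1)[OF H(1)] q_surj by auto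
      with u have "y \<in> ?P" by simp
      then have "y \<in> K" unfolding \<open>?P = K\<close> .
      with y ker show "u \<in> {\<zero>\<^bsub>Q\<^esub>}" by simp
    qed
    with H Q.submoduleD(2)[OF H(1)] show False by auto
  qed
  define A where "A = (\<lambda>a. a \<odot>\<^bsub>Q\<^esub> z) ` carrier R"
  define S where "S = Q\<lparr>carrier := A\<rparr>"
  have A: "submodule A R Q"
    unfolding A_def by (rule Q.submodule_cyclic[OF zQ])
  have S: "left_module R S"
    unfolding S_def by (rule Q.left_module_submodule[OF A])
  have zA: "z \<in> A"
    using Q.smult_one[OF zQ] by (metis A_def L.R.one_closed imageI)
  have z0: "z \<noteq> \<zero>\<^bsub>Q\<^esub>" using ker[OF xL] K(2) by (simp add: z_def)
  \<comment> \<open>\<open>A\<close> is the least submodule containing \<open>z\<close>. Together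
    with \<open>z_in\<close> this places \<open>A\<close> inside every nonzero submodule of
    \<open>Q\<close>, which forces simplicity.\<close>
  have A_sub: "A \<subseteq> H" if "submodule H R Q" "z \<in> H" for H
    using Q.submoduleD(5)[OF that(1)] that(2) by (auto simp: A_def)
  have simple: "simple_lmod R S"
    unfolding simple_lmod_def nonzero_lmod_def
  proof (intro conjI allI impI S)
    show "carrier S \<noteq> {\<zero>\<^bsub>S\<^esub>}" using zA z0 by (auto simp: S_def)
    fix H assume "submodule H R S"
    then have "submodule H R Q" "H \<subseteq> A"
      using submodule_of_submodule[OF Q A] by (auto simp: S_def)
    with z_in[of H] A_sub[of H] show "H = {\<zero>\<^bsub>S\<^esub>} \<or> H = carrier S"
      by (auto simp: S_def)
  qed
  \<comment> \<open>The homomorphism \<open>q\<close> carries \<open>\<sigma> L\<close> into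
    \<open>\<sigma> Q\<close>.\<close>
  have "z \<in> \<sigma> Q"
    using \<sigma> L(1) Q q_hom x(1) unfolding left_exact_preradical_def preradical_def z_def by blast
  then have "A \<subseteq> \<sigma> Q" using A_sub sub\<sigma>[OF Q] by blast
  \<comment> \<open>Left exactness gives \<open>\<sigma> S = A \<inter> \<sigma> Q\<close>, and
    \<open>A\<close> lies inside \<open>\<sigma> Q\<close>.\<close>
  then have \<sigma>S: "\<sigma> S = carrier S"
    using \<sigma> Q A by (auto simp: left_exact_preradical_def S_def)
  \<comment> \<open>The inclusion of \<open>S\<close> in \<open>Q\<close> is the monomorphism that
    parainjectivity turns into an epimorphism the other way.\<close>
  have "(\<lambda>y. y) \<in> lmod_mono R S Q"
    using Q.submoduleD(1)[OF A] by (auto simp: lmod_mono_def lmod_hom_def S_def inj_on_def)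
  then obtain g where "g \<in> lmod_epi R Q S"
    using para[OF simple \<sigma>S] Q unfolding parainjective_def by blast
  with q S have "lmod_quotient R L S"
    unfolding lmod_quotient_def by (blast intro: lmod_epi_comp)
  with simple \<sigma>S show ?thesis by blast
qed

theorem theorem3p17:
  fixes R :: "('r, 'x) ring_scheme"
    and \<sigma> :: "('r, 'm) module \<Rightarrow> 'm set"
  assumes "ring R"
    and "left_exact_preradical R \<sigma>"
    and "\<And>S :: ('r, 'm) module. simple_lmod R S \<Longrightarrow> \<sigma> S = carrier S \<Longrightarrow> parainjective R S"
  shows "left_max_ring R \<sigma>"
  \<comment> \<open>A quotient of any module is itself a left module, so
    \<open>ex_simple_quotient\<close> applies to it directly.\<close>
  using assms(1) ex_simple_quotient[OF assms(2,3)]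
  unfolding left_max_ring_def coatomic_def lmod_quotient_def by blast

end
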